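(* Let $K$ be a finite field, let $S=K[t_1,\ldots,t_s]$, let $X=\{P_1,\ldots,P_m\}\subset K^s$ be a set of $m\ge2$ points, let $\mathcal{L}\subset S$ be a finite-dimensional linear subspace with evaluation code $\mathcal{L}_X$ on $X$, and let $\prec$ be a monomial order on $S$. If the vanishing ideal $I(X)$ is a binomial ideal and $\mathcal{L}$ is a monomial space of $S$, then $\mathcal{L}_X$ is a standard monomial code.
   Context: $I(X)$ is the ideal of all polynomials vanishing on $X$. An ideal is binomial if it is generated by elements of the form $t^a-t^b$, where $t^a,t^b$ are monomials of $S$. A linear subspace of $S$ is a monomial space if it is the $K$-span of a finite set of monomials. The evaluation code is $\mathcal{L}_X=\{(f(P_1),\ldots,f(P_m)): f\in\mathcal{L}\}\subset K^m$. $\Delta_\prec(I(X))$ is the set of monomials not in the initial ideal $\mathrm{in}_\prec(I(X))$, and $K\Delta_\prec(I(X))$ is its $K$-span. There is a unique linear subspace $\widetilde{\mathcal{L}}\subset K\Delta_\prec(I(X))$ with $\widetilde{\mathcal{L}}_X=\mathcal{L}_X$, called the standard function space of $\mathcal{L}_X$. The code $\mathcal{L}_X$ is a standard monomial code if $\widetilde{\mathcal{L}}$ is a monomial space of $S$. *)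

theory Defs
  imports
    "HOL-Library.Poly_Mapping"
    "HOL-Analysis.Finite_Cartesian_Product"
begin

text \<open>
  The polynomial ring \<open>K[t\<^sub>1, \<dots>, t\<^sub>s]\<close> is \<open>('s \<Rightarrow>\<^sub>0 nat) \<Rightarrow>\<^sub>0 'k\<close>, where the finite type \<open>'s\<close>
  indexes the variables: a polynomial maps exponent vectors to coefficients. The ring structure
  is the convolution product of \<^theory>\<open>HOL-Library.Poly_Mapping\<close>.
\<close>

type_synonym ('s, 'k) mpoly = "('s \<Rightarrow>\<^sub>0 nat) \<Rightarrow>\<^sub>0 'k"

definition monom :: "('s \<Rightarrow>\<^sub>0 nat) \<Rightarrow> ('s, 'k::field) mpoly"
  where "monom a = Poly_Mapping.single a 1"

definition scale :: "'k::field \<Rightarrow> ('s, 'k) mpoly \<Rightarrow> ('s, 'k) mpoly"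
  where "scale c f = Poly_Mapping.single 0 c * f"

global_interpretation mpoly: vector_space "scale :: 'k::field \<Rightarrow> ('s, 'k) mpoly \<Rightarrow> ('s, 'k) mpoly"
  by unfold_locales
    (simp_all add: scale_def algebra_simps single_add mult_single flip: mult.assoc)

definition finite_dimensional :: "('s, 'k::field) mpoly set \<Rightarrow> bool"
  where "finite_dimensional L \<longleftrightarrow> (\<exists>B. finite B \<and> L = mpoly.span B)"

definition monomial_space :: "('s, 'k::field) mpoly set \<Rightarrow> bool"
  where "monomial_space L \<longleftrightarrow> (\<exists>A. finite A \<and> L = mpoly.span (monom ` A))"


text \<open>A commutative ring is a module over itself, and its submodules are its ideals. The module
  locale is not interpreted globally, because its simp rules would reassociate all products.\<close>

lemma module_times: "module ((*) :: 'a::comm_ring_1 \<Rightarrow> 'a \<Rightarrow> 'a)"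
  by unfold_locales (simp_all add: algebra_simps)

definition ideal_generated :: "'a::comm_ring_1 set \<Rightarrow> 'a set"
  where "ideal_generated B = module.span (*) B"

definition binomial_ideal :: "('s, 'k::field) mpoly set \<Rightarrow> bool"
  where "binomial_ideal I \<longleftrightarrow>
    (\<exists>B. B \<subseteq> {monom a - monom b |a b. True} \<and> I = ideal_generated B)"


definition eval :: "('s::finite, 'k::field) mpoly \<Rightarrow> 'k ^ 's \<Rightarrow> 'k"
  where "eval f x = (\<Sum>a\<in>Poly_Mapping.keys f.
    Poly_Mapping.lookup f a * (\<Prod>i\<in>UNIV. (x $ i) ^ Poly_Mapping.lookup a i))"

definition vanishing_ideal :: "('k::field ^ 's::finite) set \<Rightarrow> ('s, 'k) mpoly set"
  where "vanishing_ideal X = {f. \<forall>x\<in>X. eval f x = 0}"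

text \<open>The points \<open>P\<^sub>1, \<dots>, P\<^sub>m\<close> are a family indexed by a finite type \<open>'m\<close> with \<open>m\<close> elements.\<close>

definition evaluation_code ::
    "('m::finite \<Rightarrow> 'k::field ^ 's::finite) \<Rightarrow> ('s, 'k) mpoly set \<Rightarrow> ('k ^ 'm) set"
  where "evaluation_code P L = (\<lambda>f. \<chi> j. eval f (P j)) ` L"


text \<open>A monomial order is given as a strict order on exponent vectors.\<close>

definition monomial_order :: "(('s \<Rightarrow>\<^sub>0 nat) \<Rightarrow> ('s \<Rightarrow>\<^sub>0 nat) \<Rightarrow> bool) \<Rightarrow> bool"
  where "monomial_order prec \<longleftrightarrow>
    irreflp prec \<and> transp prec \<and> totalp prec \<and>
    (\<forall>a. a \<noteq> 0 \<longrightarrow> prec 0 a) \<and>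
    (\<forall>a b c. prec a b \<longrightarrow> prec (a + c) (b + c))"

text \<open>Only meaningful for \<open>f \<noteq> 0\<close>.\<close>

definition lead_exponent ::
    "(('s \<Rightarrow>\<^sub>0 nat) \<Rightarrow> ('s \<Rightarrow>\<^sub>0 nat) \<Rightarrow> bool) \<Rightarrow> ('s, 'k::field) mpoly \<Rightarrow> ('s \<Rightarrow>\<^sub>0 nat)"
  where "lead_exponent prec f =
    (THE a. a \<in> Poly_Mapping.keys f \<and> (\<forall>b\<in>Poly_Mapping.keys f. b \<noteq> a \<longrightarrow> prec b a))"

definition initial_ideal ::
    "(('s \<Rightarrow>\<^sub>0 nat) \<Rightarrow> ('s \<Rightarrow>\<^sub>0 nat) \<Rightarrow> bool) \<Rightarrow> ('s, 'k::field) mpoly set \<Rightarrow> ('s, 'k) mpoly set"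
  where "initial_ideal prec I = ideal_generated {monom (lead_exponent prec f) |f. f \<in> I \<and> f \<noteq> 0}"

definition standard_monomials ::
    "(('s \<Rightarrow>\<^sub>0 nat) \<Rightarrow> ('s \<Rightarrow>\<^sub>0 nat) \<Rightarrow> bool) \<Rightarrow> ('s, 'k::field) mpoly set \<Rightarrow> ('s, 'k) mpoly set"
  where "standard_monomials prec I = {monom a |a. monom a \<notin> initial_ideal prec I}"

text \<open>If \<open>prec\<close> is a monomial order and \<open>C\<close> is an evaluation code on \<open>P\<close>, there is exactly one
  such \<open>V\<close>, since evaluation is injective on the span of the standard monomials and reaches every
  codeword from it.\<close>

definition standard_function_space ::
    "(('s \<Rightarrow>\<^sub>0 nat) \<Rightarrow> ('s \<Rightarrow>\<^sub>0 nat) \<Rightarrow> bool) \<Rightarrow> ('m::finite \<Rightarrow> 'k::field ^ 's::finite) \<Rightarrow>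
      ('k ^ 'm) set \<Rightarrow> ('s, 'k) mpoly set"
  where "standard_function_space prec P C =
    (THE V. mpoly.subspace V \<and>
      V \<subseteq> mpoly.span (standard_monomials prec (vanishing_ideal (range P))) \<and>
      evaluation_code P V = C)"

definition standard_monomial_code ::
    "(('s \<Rightarrow>\<^sub>0 nat) \<Rightarrow> ('s \<Rightarrow>\<^sub>0 nat) \<Rightarrow> bool) \<Rightarrow> ('m::finite \<Rightarrow> 'k::field ^ 's::finite) \<Rightarrow>
      ('k ^ 'm) set \<Rightarrow> bool"
  where "standard_monomial_code prec P C \<longleftrightarrow> monomial_space (standard_function_space prec P C)"

end

theory Submission
  imports Defs
begin

text \<open>
  Call two exponent vectors congruent if their monomials take the same values on \<open>X\<close>. Binomials
  in \<open>I(X)\<close> are then exactly the \<open>t\<^sup>a - t\<^sup>b\<close> with \<open>a\<close> and \<open>b\<close> congruent. If such binomials generate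
  \<open>I(X)\<close>, then the coefficients of any member of \<open>I(X)\<close> add up to zero over every congruence class,
  because a monomial multiple of a generator moves a coefficient only within a class
  (\<open>binomial_vanishing_ideal_coeff_sum\<close>).

  Hence the leading monomial of a nonzero member of \<open>I(X)\<close> always has a strictly smaller congruent
  monomial: some other coefficient has to cancel the leading one within its class. Congruence and
  \<open>\<prec>\<close> are compatible with products, so this extends to all monomials of the initial ideal. The
  least element of a class is therefore a standard monomial (\<open>least_congruent_standard\<close>). Every
  class has a least element, because over a finite field each monomial is congruent to a smaller
  one with exponents below a fixed bound (\<open>ex_congruent_below\<close>).

  If \<open>L\<close> is spanned by the monomials \<open>t\<^sup>a\<close>, replacing each \<open>a\<close> by the least element of its class
  leaves the code unchanged and gives a space that is spanned by standard monomials. By uniqueness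
  this monomial space is the standard function space.
\<close>

section \<open>Weighted coefficient sums\<close>

text \<open>
  Evaluation at a point and summation of the coefficients over a congruence class are both linear
  functionals that are given by a weight on the exponents.
\<close>

definition coeff_sum :: "(('s \<Rightarrow>\<^sub>0 nat) \<Rightarrow> 'k) \<Rightarrow> ('s, 'k::field) mpoly \<Rightarrow> 'k"
  where "coeff_sum w f = (\<Sum>a\<in>Poly_Mapping.keys f. Poly_Mapping.lookup f a * w a)"

lemma coeff_sum_superset:
  assumes "finite A" "Poly_Mapping.keys f \<subseteq> A"
  shows "coeff_sum w f = (\<Sum>a\<in>A. Poly_Mapping.lookup f a * w a)"
  unfolding coeff_sum_def
  by (rule sum.mono_neutral_left) (use assms in \<open>auto simp: in_keys_iff\<close>)

lemma coeff_sum_zero [simp]: "coeff_sum w 0 = 0"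
  by (simp add: coeff_sum_def)

lemma coeff_sum_single [simp]: "coeff_sum w (Poly_Mapping.single a c) = c * w a"
  by (simp add: coeff_sum_def)

lemma coeff_sum_add: "coeff_sum w (f + g) = coeff_sum w f + coeff_sum w g"
proof -
  let ?A = "Poly_Mapping.keys f \<union> Poly_Mapping.keys g"
  have "coeff_sum w (f + g) = (\<Sum>a\<in>?A. Poly_Mapping.lookup (f + g) a * w a)"
    by (intro coeff_sum_superset keys_add) auto
  also have "\<dots> = coeff_sum w f + coeff_sum w g"
    by (simp add: coeff_sum_superset[of ?A f] coeff_sum_superset[of ?A g] lookup_add
        distrib_right sum.distrib)
  finally show ?thesis .
qed

lemma coeff_sum_diff: "coeff_sum w (f - g) = coeff_sum w f - coeff_sum w g"
  using coeff_sum_add[of w "f - g" g] by simp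

lemma poly_induct [case_names zero add_single]:
  assumes "Q 0" "\<And>f a c. Q f \<Longrightarrow> Q (f + Poly_Mapping.single a c)"
  shows "Q (f :: ('s, 'k::field) mpoly)"
proof (induction f rule: update_induct)
  case (update f a b)
  have "Poly_Mapping.update a b f = f + Poly_Mapping.single a b"
    using update.hyps
    by (intro poly_mapping_eqI) (auto simp: lookup_update lookup_add lookup_single in_keys_iff)
  then show ?case using assms(2) update.IH by simp
qed (rule assms(1))

lemma coeff_sum_scale: "coeff_sum w (scale c f) = c * coeff_sum w f"
  by (induction f rule: poly_induct)
    (simp_all add: scale_def distrib_left coeff_sum_add mult_single)

lemma keys_scale: "Poly_Mapping.keys (scale c f) \<subseteq> Poly_Mapping.keys f"
proof -
  have "{a + b |a b. a \<in> Poly_Mapping.keys (Poly_Mapping.single 0 c) \<and> b \<in> Poly_Mapping.keys f}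
      \<subseteq> Poly_Mapping.keys f"
    by auto
  with keys_mult[of "Poly_Mapping.single 0 c" f] show ?thesis
    unfolding scale_def by (rule subset_trans)
qed

lemma keys_span_monom:
  assumes "f \<in> mpoly.span (monom ` A)"
  shows "Poly_Mapping.keys f \<subseteq> A"
  using assms
proof (induction rule: mpoly.span_induct_alt)
  case (step c x y)
  then obtain a where "a \<in> A" "x = monom a" by auto
  then show ?case
    using step keys_add[of "scale c x" y] keys_scale[of c x] by (force simp: monom_def)
qed simp

section \<open>Exponents with equal monomial values\<close>

definition monomial_value :: "'k::field ^ 's::finite \<Rightarrow> ('s \<Rightarrow>\<^sub>0 nat) \<Rightarrow> 'k"
  where "monomial_value x a = (\<Prod>i\<in>UNIV. (x $ i) ^ Poly_Mapping.lookup a i)"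

lemma eval_eq_coeff_sum: "eval f x = coeff_sum (monomial_value x) f"
  by (simp add: eval_def coeff_sum_def monomial_value_def)

lemma eval_monom: "eval (monom a) x = monomial_value x a"
  by (simp add: eval_eq_coeff_sum monom_def)

lemma eval_add: "eval (f + g) x = eval f x + eval g x"
  by (simp add: eval_eq_coeff_sum coeff_sum_add)

lemma eval_diff: "eval (f - g) x = eval f x - eval g x"
  by (simp add: eval_eq_coeff_sum coeff_sum_diff)

lemma eval_scale: "eval (scale c f) x = c * eval f x"
  by (simp add: eval_eq_coeff_sum coeff_sum_scale)

lemma monomial_value_add: "monomial_value x (a + b) = monomial_value x a * monomial_value x b"
  by (simp add: monomial_value_def lookup_add power_add prod.distrib)

lemma monomial_value_single: "monomial_value x (Poly_Mapping.single i n) = (x $ i) ^ n"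
proof -
  have "monomial_value x (Poly_Mapping.single i n) = (\<Prod>j\<in>UNIV. if i = j then (x $ j) ^ n else 1)"
    unfolding monomial_value_def by (intro prod.cong) (auto simp: lookup_single)
  then show ?thesis by simp
qed

definition congruent_exponents ::
    "('m \<Rightarrow> 'k::field ^ 's::finite) \<Rightarrow> ('s \<Rightarrow>\<^sub>0 nat) \<Rightarrow> ('s \<Rightarrow>\<^sub>0 nat) \<Rightarrow> bool"
  where "congruent_exponents P a b \<longleftrightarrow> (\<forall>j. monomial_value (P j) a = monomial_value (P j) b)"

lemma congruent_exponents_refl [simp]: "congruent_exponents P a a"
  by (simp add: congruent_exponents_def)

lemma congruent_exponents_sym: "congruent_exponents P a b \<Longrightarrow> congruent_exponents P b a"
  by (simp add: congruent_exponents_def)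

lemma congruent_exponents_trans:
  "congruent_exponents P a b \<Longrightarrow> congruent_exponents P b c \<Longrightarrow> congruent_exponents P a c"
  by (simp add: congruent_exponents_def)

lemma congruent_exponents_add:
  "congruent_exponents P a b \<Longrightarrow> congruent_exponents P (a + c) (b + c)"
  by (simp add: congruent_exponents_def monomial_value_add)

lemma binomial_in_vanishing_ideal_iff:
  "monom a - monom b \<in> vanishing_ideal (range P) \<longleftrightarrow> congruent_exponents P a b"
  by (auto simp: vanishing_ideal_def eval_diff eval_monom congruent_exponents_def)

lemma coeff_sum_mult_binomial:
  assumes "\<And>c. w (c + a) = w (c + b)"
  shows "coeff_sum w (p * (monom a - monom b)) = 0"
proof (induction p rule: poly_induct)
  case (add_single p c k)
  have "Poly_Mapping.single c k * (monom a - monom b)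
      = Poly_Mapping.single (c + a) k - Poly_Mapping.single (c + b) k"
    by (simp add: monom_def right_diff_distrib mult_single)
  then show ?case
    using add_single assms by (simp add: distrib_right coeff_sum_add coeff_sum_diff)
qed simp

lemma ideal_generated_superset: "B \<subseteq> ideal_generated B"
  unfolding ideal_generated_def by (rule module.span_superset[OF module_times])

lemma ideal_generated_induct [consumes 1, case_names zero step]:
  assumes "f \<in> ideal_generated B" "Q 0" "\<And>p g f. g \<in> B \<Longrightarrow> Q f \<Longrightarrow> Q (p * g + f)"
  shows "Q f"
  using assms module.span_induct_alt[OF module_times, of f B Q] by (simp add: ideal_generated_def)

text \<open>
  Any functional that does not distinguish congruent exponents kills a binomial vanishing ideal;
  the relevant weights are the indicator functions of the congruence classes.
\<close>

lemma binomial_vanishing_ideal_coeff_sum: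
  fixes P :: "'m \<Rightarrow> 'k::field ^ 's::finite"
  assumes "binomial_ideal (vanishing_ideal (range P))" "f \<in> vanishing_ideal (range P)"
    and w: "\<And>a b. congruent_exponents P a b \<Longrightarrow> w a = w b"
  shows "coeff_sum w f = 0"
proof -
  obtain B :: "('s, 'k) mpoly set" where B: "B \<subseteq> {monom a - monom b |a b. True}"
    and I: "vanishing_ideal (range P) = ideal_generated B"
    using assms(1) by (auto simp: binomial_ideal_def)
  have "f \<in> ideal_generated B" using assms(2) I by simp
  then show ?thesis
  proof (induction rule: ideal_generated_induct)
    case (step p g f)
    obtain a b where g: "g = monom a - monom b" using B step.hyps by blast
    have "g \<in> vanishing_ideal (range P)" using I ideal_generated_superset step.hyps by blast
    then have "congruent_exponents P a b" by (simp add: g binomial_in_vanishing_ideal_iff)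
    then have "w (c + a) = w (c + b)" for c
      using w congruent_exponents_add[of P a b c] by (simp add: add.commute)
    then show ?case using step.IH g by (simp add: coeff_sum_add coeff_sum_mult_binomial)
  qed simp
qed

section \<open>Leading and standard exponents\<close>

lemma lead_exponent_greatest:
  assumes "monomial_order prec" "f \<noteq> 0"
  shows "lead_exponent prec f \<in> Poly_Mapping.keys f"
    and "\<And>b. b \<in> Poly_Mapping.keys f \<Longrightarrow> b \<noteq> lead_exponent prec f \<Longrightarrow> prec b (lead_exponent prec f)"
proof -
  let ?K = "Poly_Mapping.keys f"
  have ord: "irreflp prec" "transp prec" "totalp prec"
    using assms(1) by (auto simp: monomial_order_def)
  have asym: "\<not> prec b a" if "prec a b" for a b
    using that ord by (meson irreflpD transpD)
  have "\<exists>a\<in>?K. \<forall>b\<in>?K. b \<noteq> a \<longrightarrow> prec b a"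
    using assms(2) ord
    by (intro Finite_Set.bex_greatest_element)
      (auto intro: transp_on_subset totalp_on_subset)
  then have "\<exists>!a. a \<in> ?K \<and> (\<forall>b\<in>?K. b \<noteq> a \<longrightarrow> prec b a)"
    using asym by metis
  from theI'[OF this]
  show "lead_exponent prec f \<in> ?K"
    and "\<And>b. b \<in> ?K \<Longrightarrow> b \<noteq> lead_exponent prec f \<Longrightarrow> prec b (lead_exponent prec f)"
    by (auto simp: lead_exponent_def)
qed

lemma monom_in_ideal_generated_monomials:
  fixes E :: "('s \<Rightarrow>\<^sub>0 nat) set"
  assumes "(monom b :: ('s, 'k::field) mpoly) \<in> ideal_generated (monom ` E)"
  shows "\<exists>a\<in>E. \<exists>c. b = a + c"
proof -
  have "Poly_Mapping.keys f \<subseteq> {a + c |a c. a \<in> E}"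
    if "f \<in> ideal_generated (monom ` E)" for f :: "('s, 'k) mpoly"
    using that
  proof (induction rule: ideal_generated_induct)
    case (step p g f)
    then obtain a where a: "a \<in> E" "g = monom a" by auto
    have "{d + e |d e. d \<in> Poly_Mapping.keys p \<and> e \<in> Poly_Mapping.keys g}
        \<subseteq> {a + c |a c. a \<in> E}"
      using a by (auto simp: monom_def intro: add.commute)
    with keys_mult have "Poly_Mapping.keys (p * g) \<subseteq> {a + c |a c. a \<in> E}"
      by (rule subset_trans)
    then show ?case using step.IH keys_add[of "p * g" f] by blast
  qed simp
  from this[OF assms] show ?thesis by (auto simp: monom_def)
qed

definition standard_exponents ::
    "(('s \<Rightarrow>\<^sub>0 nat) \<Rightarrow> ('s \<Rightarrow>\<^sub>0 nat) \<Rightarrow> bool) \<Rightarrow> ('s, 'k::field) mpoly set \<Rightarrow> ('s \<Rightarrow>\<^sub>0 nat) set"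
  where "standard_exponents prec I = {a. monom a \<notin> initial_ideal prec I}"

lemma standard_monomials_eq: "standard_monomials prec I = monom ` standard_exponents prec I"
  by (auto simp: standard_monomials_def standard_exponents_def)

text \<open>
  The leading exponent of a nonzero member of \<open>I\<close> is never standard. This makes evaluation
  injective on the span of the standard monomials.
\<close>

lemma eq_0_if_standard_keys:
  assumes "monomial_order prec" "f \<in> I" "Poly_Mapping.keys f \<subseteq> standard_exponents prec I"
  shows "f = 0"
proof (rule ccontr)
  assume "f \<noteq> 0"
  then have "monom (lead_exponent prec f) \<in> initial_ideal prec I"
    unfolding initial_ideal_def using assms(2)
    by (intro subsetD[OF ideal_generated_superset]) auto
  then show False
    using lead_exponent_greatest(1)[OF assms(1) \<open>f \<noteq> 0\<close>] assms(3)
    by (auto simp: standard_exponents_def)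
qed

definition least_congruent ::
    "(('s \<Rightarrow>\<^sub>0 nat) \<Rightarrow> ('s \<Rightarrow>\<^sub>0 nat) \<Rightarrow> bool) \<Rightarrow> ('m \<Rightarrow> 'k::field ^ 's::finite) \<Rightarrow> ('s \<Rightarrow>\<^sub>0 nat) \<Rightarrow> bool"
  where "least_congruent prec P b \<longleftrightarrow> (\<forall>c. congruent_exponents P c b \<longrightarrow> \<not> prec c b)"

text \<open>
  If \<open>t\<^sup>b\<close> were in the initial ideal, then \<open>b = a + c\<close> for the leading exponent \<open>a\<close> of some \<open>f\<close> in
  the ideal. The class sum of \<open>a\<close> in \<open>f\<close> is zero, so \<open>f\<close> has a second exponent \<open>a'\<close> in that class;
  then \<open>a' + c\<close> is congruent to \<open>b\<close> and smaller.
\<close>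

lemma least_congruent_standard:
  fixes P :: "'m \<Rightarrow> 'k::field ^ 's::finite"
  assumes ord: "monomial_order prec"
    and bin: "binomial_ideal (vanishing_ideal (range P))"
    and least: "least_congruent prec P b"
  shows "b \<in> standard_exponents prec (vanishing_ideal (range P))"
proof (rule ccontr)
  let ?I = "vanishing_ideal (range P)"
  assume "b \<notin> standard_exponents prec ?I"
  moreover have "{monom (lead_exponent prec f) |f. f \<in> ?I \<and> f \<noteq> 0}
      = (monom ` {lead_exponent prec f |f. f \<in> ?I \<and> f \<noteq> 0} :: ('s, 'k) mpoly set)"
    by auto
  ultimately have "(monom b :: ('s, 'k) mpoly)
      \<in> ideal_generated (monom ` {lead_exponent prec f |f. f \<in> ?I \<and> f \<noteq> 0})"
    by (simp add: standard_exponents_def initial_ideal_def)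
  from monom_in_ideal_generated_monomials[OF this] obtain f c
    where f: "f \<in> ?I" "f \<noteq> 0" and b: "b = lead_exponent prec f + c" by blast
  define a where "a = lead_exponent prec f"
  define w where "w d = (if congruent_exponents P d a then 1 else 0 :: 'k)" for d
  have a: "a \<in> Poly_Mapping.keys f" using lead_exponent_greatest(1)[OF ord f(2)] by (simp add: a_def)
  have "coeff_sum w f = 0"
    using bin f(1)
  proof (rule binomial_vanishing_ideal_coeff_sum)
    show "w d = w e" if "congruent_exponents P d e" for d e
      unfolding w_def using that congruent_exponents_sym congruent_exponents_trans by metis
  qed
  moreover have "coeff_sum w f
      = Poly_Mapping.lookup f a + (\<Sum>d\<in>Poly_Mapping.keys f - {a}. Poly_Mapping.lookup f d * w d)"
    unfolding coeff_sum_def using a by (simp add: sum.remove w_def)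
  ultimately have "(\<Sum>d\<in>Poly_Mapping.keys f - {a}. Poly_Mapping.lookup f d * w d) \<noteq> 0"
    using a by (auto simp: in_keys_iff)
  then obtain a' where "a' \<in> Poly_Mapping.keys f - {a}" "Poly_Mapping.lookup f a' * w a' \<noteq> 0"
    by (meson sum.not_neutral_contains_not_neutral)
  then have a': "a' \<in> Poly_Mapping.keys f" "a' \<noteq> a" "congruent_exponents P a' a"
    by (auto simp: w_def split: if_splits)
  have "prec a' a" using lead_exponent_greatest(2)[OF ord f(2) a'(1)] a'(2) by (simp add: a_def)
  then have "prec (a' + c) b" using ord by (simp add: monomial_order_def b a_def)
  moreover have "congruent_exponents P (a' + c) b"
    using congruent_exponents_add[OF a'(3)] by (simp add: b a_def)
  ultimately show False using least by (auto simp: least_congruent_def)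
qed

section \<open>Least congruent exponents over a finite field\<close>

lemma finite_bounded_exponents: "finite {a :: 's::finite \<Rightarrow>\<^sub>0 nat. \<forall>i. Poly_Mapping.lookup a i < n}"
proof (rule finite_imageD)
  show "finite (Poly_Mapping.lookup ` {a :: 's \<Rightarrow>\<^sub>0 nat. \<forall>i. Poly_Mapping.lookup a i < n})"
    by (rule finite_subset[of _ "Pi\<^sub>E UNIV (\<lambda>_. {..<n})"]) (auto intro: finite_PiE)
qed (auto intro: inj_onI poly_mapping_eqI)

text \<open>There are only finitely many functions on a finite field, so the power functions repeat.\<close>

lemma ex_equal_powers: "\<exists>i j. i < j \<and> (\<forall>x :: 'k::{field, finite}. x ^ i = x ^ j)"
proof -
  have "\<not> inj (\<lambda>n (x::'k). x ^ n)"
    using finite_imageD[of "\<lambda>n (x::'k). x ^ n" UNIV] by auto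
  then obtain i j where "i \<noteq> j" "(\<lambda>x::'k. x ^ i) = (\<lambda>x. x ^ j)" by (auto simp: inj_def)
  then show ?thesis by (metis linorder_neqE_nat)
qed

text \<open>
  An exponent of at least \<open>j\<close> can be lowered by \<open>j - i\<close> when \<open>x\<^sup>i = x\<^sup>j\<close> holds on the field. This
  keeps the values of the monomial and divides it by a nontrivial monomial, so it gets smaller in
  every monomial order.
\<close>

lemma ex_congruent_below:
  fixes P :: "'m \<Rightarrow> 'k::{field, finite} ^ 's::finite"
  assumes ord: "monomial_order prec"
    and ij: "i < j" "\<forall>x :: 'k. x ^ i = x ^ j"
  shows "\<exists>b. (\<forall>v. Poly_Mapping.lookup b v < j) \<and> congruent_exponents P b a \<and> (b = a \<or> prec b a)"
proof (induction "\<Sum>v\<in>UNIV. Poly_Mapping.lookup a v" arbitrary: a rule: less_induct)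
  case less
  show ?case
  proof (cases "\<forall>v. Poly_Mapping.lookup a v < j")
    case False
    then obtain v where v: "j \<le> Poly_Mapping.lookup a v" by (auto simp: not_less)
    define c where "c = a - Poly_Mapping.single v j"
    define a' where "a' = c + Poly_Mapping.single v i"
    define d where "d = Poly_Mapping.single v (j - i)"
    have a: "a = c + Poly_Mapping.single v j"
      by (rule poly_mapping_eqI) (use v in \<open>auto simp: c_def lookup_add lookup_minus lookup_single when_def\<close>)
    have a_d: "a = a' + d"
      using ij(1) by (simp add: a a'_def d_def add.assoc flip: single_add)
    have "Poly_Mapping.lookup d v \<noteq> 0" using ij(1) by (simp add: d_def)
    then have "d \<noteq> 0" by auto
    then have "prec (0 + a') (d + a')" using ord unfolding monomial_order_def by blast
    then have small: "prec a' a" by (simp add: a_d add.commute)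
    have cong: "congruent_exponents P a' a"
      using ij(2) by (simp add: congruent_exponents_def a a'_def monomial_value_add monomial_value_single)
    have "(\<Sum>u\<in>UNIV. Poly_Mapping.lookup a' u) < (\<Sum>u\<in>UNIV. Poly_Mapping.lookup a u)"
      by (rule sum_strict_mono_ex1)
        (use \<open>Poly_Mapping.lookup d v \<noteq> 0\<close> in \<open>auto simp: a_d lookup_add\<close>)
    from less[OF this] obtain b where b: "\<forall>v. Poly_Mapping.lookup b v < j"
      "congruent_exponents P b a'" "b = a' \<or> prec b a'" by blast
    have "prec b a" using b(3) small ord by (auto simp: monomial_order_def dest: transpD)
    then show ?thesis using b congruent_exponents_trans[OF b(2) cong] by blast
  qed auto
qed

lemma ex_least_congruent:
  fixes P :: "'m \<Rightarrow> 'k::{field, finite} ^ 's::finite"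
  assumes ord: "monomial_order prec"
  shows "\<exists>b. congruent_exponents P a b \<and> least_congruent prec P b"
proof -
  obtain i j where ij: "i < j" "\<forall>x :: 'k. x ^ i = x ^ j" using ex_equal_powers by blast
  let ?B = "{b. (\<forall>v. Poly_Mapping.lookup b v < j) \<and> congruent_exponents P b a}"
  note below = ex_congruent_below[OF ord ij, of P]
  have prec: "irreflp prec" "transp prec" "totalp prec"
    using ord by (auto simp: monomial_order_def)
  have "finite ?B" by (rule finite_subset[OF _ finite_bounded_exponents[of j]]) auto
  moreover have "?B \<noteq> {}" using below[of a] by blast
  ultimately obtain b where b: "b \<in> ?B" "\<And>c. c \<in> ?B \<Longrightarrow> c \<noteq> b \<Longrightarrow> prec b c"
    using Finite_Set.bex_least_element[of ?B prec] prec
    by (auto intro: transp_on_subset totalp_on_subset)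
  have "least_congruent prec P b"
    unfolding least_congruent_def
  proof (intro allI impI notI)
    fix c assume c: "congruent_exponents P c b" "prec c b"
    obtain c' where c': "\<forall>v. Poly_Mapping.lookup c' v < j" "congruent_exponents P c' c"
      "c' = c \<or> prec c' c" using below by blast
    have "congruent_exponents P c' a" using b(1) c(1) c'(2) congruent_exponents_trans by blast
    then have "c' = b \<or> prec b c'" using b(2)[of c'] c'(1) by blast
    then show False using c(2) c'(3) prec by (meson irreflpD transpD)
  qed
  then show ?thesis using b(1) congruent_exponents_sym by blast
qed

section \<open>Codes of monomial spaces\<close>

lemma evaluation_code_span_mono:
  assumes "\<And>a. a \<in> A \<Longrightarrow> \<exists>b\<in>A'. congruent_exponents P a b"
  shows "evaluation_code P (mpoly.span (monom ` A)) \<subseteq> evaluation_code P (mpoly.span (monom ` A'))"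
proof -
  have "\<exists>g\<in>mpoly.span (monom ` A'). \<forall>j. eval f (P j) = eval g (P j)"
    if "f \<in> mpoly.span (monom ` A)" for f
    using that
  proof (induction rule: mpoly.span_induct_alt)
    case base
    then show ?case using mpoly.span_zero by blast
  next
    case (step c x y)
    then obtain a b g where x: "x = monom a" and b: "b \<in> A'" "congruent_exponents P a b"
      and g: "g \<in> mpoly.span (monom ` A')" "\<forall>j. eval y (P j) = eval g (P j)"
      using assms by blast
    have "scale c (monom b) + g \<in> mpoly.span (monom ` A')"
      using b(1) g(1) by (simp add: mpoly.span_add mpoly.span_scale mpoly.span_base)
    moreover have "\<forall>j. eval (scale c x + y) (P j) = eval (scale c (monom b) + g) (P j)"
      using b(2) g(2) by (simp add: x eval_add eval_scale eval_monom congruent_exponents_def)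
    ultimately show ?case by blast
  qed
  then show ?thesis unfolding evaluation_code_def by (fastforce simp: vec_eq_iff)
qed

lemma standard_subspace_mono_code:
  assumes ord: "monomial_order prec"
    and V: "V \<subseteq> mpoly.span (standard_monomials prec (vanishing_ideal (range P)))"
    and W: "W \<subseteq> mpoly.span (standard_monomials prec (vanishing_ideal (range P)))"
    and code: "evaluation_code P V \<subseteq> evaluation_code P W"
  shows "V \<subseteq> W"
proof
  fix f assume f: "f \<in> V"
  then obtain g where g: "g \<in> W" "\<forall>j. eval f (P j) = eval g (P j)"
    using code unfolding evaluation_code_def by (fastforce simp: vec_eq_iff)
  have "f - g \<in> mpoly.span (standard_monomials prec (vanishing_ideal (range P)))"
    using f g(1) V W by (blast intro: mpoly.span_diff)
  then have "Poly_Mapping.keys (f - g) \<subseteq> standard_exponents prec (vanishing_ideal (range P))"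
    unfolding standard_monomials_eq by (rule keys_span_monom)
  moreover have "f - g \<in> vanishing_ideal (range P)"
    using g(2) by (simp add: vanishing_ideal_def eval_diff)
  ultimately have "f - g = 0" using eq_0_if_standard_keys[OF ord] by blast
  then show "f \<in> W" using g(1) by simp
qed

lemma standard_function_space_eqI:
  assumes "monomial_order prec" "mpoly.subspace V"
    and "V \<subseteq> mpoly.span (standard_monomials prec (vanishing_ideal (range P)))"
    and "evaluation_code P V = C"
  shows "standard_function_space prec P C = V"
  unfolding standard_function_space_def
  using assms by (intro the_equality) (auto dest: standard_subspace_mono_code)

theorem proposition3p8:
  fixes P :: "'m::finite \<Rightarrow> 'k::{field, finite} ^ 's::finite"
    and L :: "('s, 'k) mpoly set"
    and prec :: "('s \<Rightarrow>\<^sub>0 nat) \<Rightarrow> ('s \<Rightarrow>\<^sub>0 nat) \<Rightarrow> bool"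
  assumes "inj P"
    and "CARD('m) \<ge> 2"
    and "mpoly.subspace L"
    and "finite_dimensional L"
    and "monomial_order prec"
    and "binomial_ideal (vanishing_ideal (range P))"
    and "monomial_space L"
  shows "standard_monomial_code prec P (evaluation_code P L)"
proof -
  obtain A where A: "finite A" "L = mpoly.span (monom ` A)"
    using assms(7) by (auto simp: monomial_space_def)
  obtain n where n: "\<And>a. congruent_exponents P a (n a)" "\<And>a. least_congruent prec P (n a)"
    using ex_least_congruent[OF assms(5), of P] by metis
  let ?V = "mpoly.span (monom ` n ` A) :: ('s, 'k) mpoly set"
  have "monom ` n ` A \<subseteq> standard_monomials prec (vanishing_ideal (range P))"
    unfolding standard_monomials_eq
    using least_congruent_standard[OF assms(5,6) n(2)] by blast
  then have "?V \<subseteq> mpoly.span (standard_monomials prec (vanishing_ideal (range P)))"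
    by (rule mpoly.span_mono)
  moreover have "evaluation_code P ?V = evaluation_code P L"
    unfolding A(2)
    by (intro subset_antisym evaluation_code_span_mono)
      (use n(1) congruent_exponents_sym in \<open>blast+\<close>)
  ultimately have "standard_function_space prec P (evaluation_code P L) = ?V"
    using assms(5) by (intro standard_function_space_eqI) auto
  then show ?thesis
    using A(1) unfolding standard_monomial_code_def monomial_space_def by blast
qed

end
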